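(* Let $\mathcal H$ be a real Hilbert space, let $f:\mathcal H\to\mathbb R$ be a convex function whose gradient is Lipschitz continuous and such that $\operatorname{argmin}_{\mathcal H} f\ne\emptyset$, and let $\alpha>0$. Assume that $f$ is $\mathcal C^2$. The high resolution ODE, with temporal step size $\sqrt s$, of the algorithm (NAG$_\alpha$) gives the inertial dynamic with Hessian driven damping $$\ddot X(t)+\sqrt s\,\nabla^2 f(X(t))\dot X(t)+\frac{\alpha}{t}\dot X(t)+\left(1+\frac{\alpha\sqrt s}{2t}\right)\nabla f(X(t))=0 .$$
   Context: The Nesterov accelerated gradient algorithm (NAG$_\alpha$) with step size $s>0$ is $$y_k=x_k+\left(1-\tfrac{\alpha}{k}\right)(x_k-x_{k-1}),\qquad x_{k+1}=y_k-s\nabla f(y_k).$$ The "high resolution ODE with temporal step size $h=\sqrt s$" is understood in the following formal sense. One makes the ansatz $x_k=X(t_k)$ for some smooth curve $t\mapsto X(t)$ defined for $t\ge t_0>0$, where $t_k=h(k+c)$ with $c$ a real parameter to be adjusted, and performs a Taylor expansion in powers of $h$ (for $h$ close to zero) of the quantities entering the algorithm, the recursion being divided by $h^2=s$ and normalized so that $\ddot X$ has coefficient $1$. Instead of letting $h\to0$, one keeps the terms of order $h=\sqrt s$ in the expansion and discards the terms of order $h^2=s$ and higher. *)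

theory Defs
  imports "HOL-Analysis.Analysis" "HOL-Library.Landau_Symbols"
begin

section \<open>Gradient and Hessian on a Hilbert space\<close>

definition gradient :: "('a::real_inner \<Rightarrow> real) \<Rightarrow> 'a \<Rightarrow> 'a" where
  "gradient f x = (THE D. GDERIV f x :> D)"

definition hessian :: "('a::real_inner \<Rightarrow> real) \<Rightarrow> 'a \<Rightarrow> 'a \<Rightarrow> 'a" where
  "hessian f x = frechet_derivative (gradient f) (at x)"

text \<open>
  On a Hilbert space the derivative of \<open>f\<close> is identified with its gradient, so
  \<open>f\<close> is of class C2 iff the gradient exists everywhere and is continuously
  Frechet differentiable (continuity of the Hessian being in operator norm).
\<close>

definition C2 :: "('a::real_inner \<Rightarrow> real) \<Rightarrow> bool" where
  "C2 f \<longleftrightarrow> (\<forall>x. GDERIV f x :> gradient f x) \<and>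
     (\<exists>H :: 'a \<Rightarrow> 'a \<Rightarrow>\<^sub>L 'a.
        (\<forall>x. (gradient f has_derivative blinfun_apply (H x)) (at x)) \<and>
        continuous_on UNIV H)"

section \<open>The accelerated gradient algorithm\<close>

text \<open>
  One iteration \<open>x\<^sub>k\<^sub>+\<^sub>1 = nag_step f \<alpha> s k x\<^sub>k\<^sub>-\<^sub>1 x\<^sub>k\<close>.  The index \<open>k\<close> enters only
  through \<open>\<alpha> / k\<close>; it is a real number because the ansatz replaces it by
  \<open>k = t / h - c\<close>.
\<close>

definition nag_extrapolation :: "real \<Rightarrow> real \<Rightarrow> 'a::real_vector \<Rightarrow> 'a \<Rightarrow> 'a" where
  "nag_extrapolation \<alpha> k x_prev x = x + (1 - \<alpha> / k) *\<^sub>R (x - x_prev)"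

definition nag_step ::
  "('a::real_inner \<Rightarrow> real) \<Rightarrow> real \<Rightarrow> real \<Rightarrow> real \<Rightarrow> 'a \<Rightarrow> 'a \<Rightarrow> 'a" where
  "nag_step f \<alpha> s k x_prev x =
     (let y = nag_extrapolation \<alpha> k x_prev x in y - s *\<^sub>R gradient f y)"

section \<open>High resolution ODEs\<close>

definition smooth_curve_on :: "real set \<Rightarrow> (real \<Rightarrow> 'a::real_normed_vector) \<Rightarrow> bool" where
  "smooth_curve_on T X \<longleftrightarrow>
     (\<exists>D :: nat \<Rightarrow> real \<Rightarrow> 'a. (\<forall>t\<in>T. D 0 t = X t) \<and>
        (\<forall>n. \<forall>t\<in>T. (D n has_vector_derivative D (Suc n) t) (at t within T)))"

abbreviation velocity :: "(real \<Rightarrow> 'a::real_normed_vector) \<Rightarrow> real \<Rightarrow> 'a" where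
  "velocity X t \<equiv> vector_derivative X (at t)"

abbreviation acceleration :: "(real \<Rightarrow> 'a::real_normed_vector) \<Rightarrow> real \<Rightarrow> 'a" where
  "acceleration X t \<equiv> vector_derivative (velocity X) (at t)"

text \<open>
  The recursion \<open>x\<^sub>k\<^sub>+\<^sub>1 - \<Phi> s k x\<^sub>k\<^sub>-\<^sub>1 x\<^sub>k = 0\<close> with step size \<open>s = h^2\<close>, divided by \<open>h^2\<close>,
  after substituting the ansatz \<open>x\<^sub>k = X t\<^sub>k\<close> with \<open>t\<^sub>k = h (k + c)\<close>; here \<open>t = t\<^sub>k\<close>.
\<close>

definition ansatz_residual ::
  "(real \<Rightarrow> real \<Rightarrow> 'a \<Rightarrow> 'a \<Rightarrow> 'a::real_normed_vector)
     \<Rightarrow> real \<Rightarrow> (real \<Rightarrow> 'a) \<Rightarrow> real \<Rightarrow> real \<Rightarrow> 'a" where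
  "ansatz_residual \<Phi> c X h t =
     (1 / h\<^sup>2) *\<^sub>R (X (t + h) - \<Phi> (h\<^sup>2) (t / h - c) (X (t - h)) (X t))"

text \<open>
  The equation \<open>E s t (X t) (X' t) (X'' t) = 0\<close> is the high resolution ODE, with
  temporal step size \<open>h = sqrt s\<close>, of the scheme \<open>\<Phi>\<close> for the time shift \<open>c\<close> if
  \<^item> \<open>E\<close> has second-order coefficient 1 and consists of terms of order \<open>h^0\<close> and
    \<open>h^1\<close> only, and
  \<^item> for every smooth curve \<open>X\<close> (not only for solutions), \<open>E\<close> is the first-order
    Taylor expansion in \<open>h\<close> of the residual, up to a nonzero scalar factor \<open>\<nu> h t\<close>,
    the same for all curves, which normalizes the coefficient of \<open>X''\<close>.

  As the gradient of a C2 function is merely C1, the discarded remainder is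
  expressed in Peano form, as \<open>o(h)\<close> for each fixed \<open>t\<close>.
\<close>

definition high_resolution_ode ::
  "(real \<Rightarrow> real \<Rightarrow> 'a \<Rightarrow> 'a \<Rightarrow> 'a::real_normed_vector)
     \<Rightarrow> real \<Rightarrow> (real \<Rightarrow> real \<Rightarrow> 'a \<Rightarrow> 'a \<Rightarrow> 'a \<Rightarrow> 'a) \<Rightarrow> bool" where
  "high_resolution_ode \<Phi> c E \<longleftrightarrow>
     (\<exists>G\<^sub>0 G\<^sub>1. \<forall>s>0. \<forall>t>0. \<forall>x v a. E s t x v a = a + G\<^sub>0 t x v + sqrt s *\<^sub>R G\<^sub>1 t x v) \<and>
     (\<exists>\<nu> :: real \<Rightarrow> real \<Rightarrow> real. (\<forall>h>0. \<forall>t>0. \<nu> h t \<noteq> 0) \<and>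
        (\<forall>t\<^sub>0>0. \<forall>X. smooth_curve_on {t\<^sub>0..} X \<longrightarrow>
           (\<forall>t>t\<^sub>0. (\<lambda>h. norm (\<nu> h t *\<^sub>R ansatz_residual \<Phi> c X h t
                       - E (h\<^sup>2) t (X t) (velocity X t) (acceleration X t)))
                     \<in> o[at_right 0](\<lambda>h. h))))"

end

theory Submission
  imports Defs
begin

text \<open>
  Fix \<open>t\<close> and a smooth curve \<open>X\<close>, write \<open>\<beta> = \<alpha> / (2 t)\<close>, and take the time shift
  \<open>c = -\<alpha>/2\<close> together with the normalizing factor \<open>\<nu> = 1 + \<beta> h\<close>.  The index attached to
  \<open>t\<close> is then \<open>k = t / h + \<alpha> / 2\<close>, so that \<open>h k = t \<nu>\<close>, and the coefficient \<open>\<alpha> / k\<close> of the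
  extrapolation satisfies \<open>\<nu> \<alpha> / k = \<alpha> h / t\<close> exactly.  This is what
  singles out the shift: multiplying the residual by \<open>\<nu>\<close> gives
  \<open>(\<nu>/h\<^sup>2) (X (t + h) - 2 X t + X (t - h)) + (\<alpha>/(t h)) (X t - X (t - h)) + \<nu> \<nabla>f (Y h)\<close>,
  where \<open>Y h\<close> is the extrapolated point.  The three summands expand up to \<open>o(h)\<close> as follows.
  \<^item> The symmetric second difference quotient is \<open>X''\<close>, without a term of order \<open>h\<close>, so the
    first summand contributes \<open>(1 + \<beta> h) X''\<close>.
  \<^item> The backward quotient is \<open>X' - (h/2) X''\<close>, so the second summand contributes
    \<open>(\<alpha>/t) X' - \<beta> h X''\<close>; its last term normalizes the coefficient of \<open>X''\<close> to 1.
  \<^item> The curve \<open>Y\<close> starts at \<open>X\<close> with velocity \<open>X'\<close>, so the gradient along it is \<open>\<nabla>f(X) + h \<nabla>\<^sup>2f(X) X'\<close>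
    by the chain rule, and the factor \<open>\<nu>\<close> produces \<open>(1 + \<beta> h) \<nabla>f(X) + h \<nabla>\<^sup>2f(X) X'\<close>.

  The sum is the asserted equation with \<open>h = sqrt s\<close>.  The Taylor remainders are obtained by integrating
  the first-order remainders of \<open>X'\<close> and \<open>X''\<close> by means of the mean value inequality
  (\<open>norm_smallo_integrate\<close>), since the curves take values in a space without coordinates.
\<close>

section \<open>Remainders of vector-valued curves\<close>

lemma norm_add_smallo:
  fixes u v :: "'b \<Rightarrow> 'a::real_normed_vector"
  assumes "(\<lambda>h. norm (u h)) \<in> o[F](g)" "(\<lambda>h. norm (v h)) \<in> o[F](g)"
  shows "(\<lambda>h. norm (u h + v h)) \<in> o[F](g)"
proof -
  have "(\<lambda>h. norm (u h) + norm (v h)) \<in> o[F](g)"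
    using assms by (rule sum_in_smallo)
  moreover have "(\<lambda>h. norm (u h + v h)) \<in> O[F](\<lambda>h. norm (u h) + norm (v h))"
    by (rule landau_o.bigI[of 1]) (auto intro!: always_eventually norm_triangle_ineq)
  ultimately show ?thesis by (rule landau_o.big_small_trans[rotated])
qed

lemma norm_scaleR_smallo:
  fixes u :: "'b \<Rightarrow> 'a::real_normed_vector" and a :: "'b \<Rightarrow> real"
  assumes "a \<in> O[F](p)" "(\<lambda>h. norm (u h)) \<in> o[F](q)"
  shows "(\<lambda>h. norm (a h *\<^sub>R u h)) \<in> o[F](\<lambda>h. p h * q h)"
proof -
  have "(\<lambda>h. \<bar>a h\<bar>) \<in> O[F](p)" using assms(1) by simp
  from landau_o.big_small_mult[OF this assms(2)] show ?thesis by simp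
qed

lemma has_vector_derivative_smallo_remainder:
  fixes g :: "real \<Rightarrow> 'a::real_normed_vector"
  assumes "(g has_vector_derivative D) (at 0)"
  shows "(\<lambda>h. norm (g h - g 0 - h *\<^sub>R D)) \<in> o[at_right 0](\<lambda>h. h)"
proof -
  have "((\<lambda>h. norm (g (0 + h) - g 0 - h *\<^sub>R D) / norm h) \<longlongrightarrow> 0) (at 0)"
    using assms unfolding has_vector_derivative_def has_derivative_at by blast
  then have "((\<lambda>h. norm (g h - g 0 - h *\<^sub>R D) / norm h) \<longlongrightarrow> 0) (at_right 0)"
    by (simp add: filterlim_at_split)
  moreover have "\<forall>\<^sub>F h in at_right 0. norm (g h - g 0 - h *\<^sub>R D) / norm h
      = norm (g h - g 0 - h *\<^sub>R D) / (h::real)"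
    by (auto simp: eventually_at_right_field intro!: exI[of _ 1])
  ultimately have "((\<lambda>h. norm (g h - g 0 - h *\<^sub>R D) / h) \<longlongrightarrow> 0) (at_right 0)"
    by (rule Lim_transform_eventually)
  then show ?thesis
    by (rule smalloI_tendsto) (auto simp: eventually_at_right_field intro!: exI[of _ 1])
qed

text \<open>
  Integrating a remainder raises its order by one: on \<open>[0, h]\<close> the derivative is
  bounded by \<open>\<epsilon> h\<^sup>n\<close>, and the mean value inequality multiplies this by the length \<open>h\<close>.
\<close>

lemma norm_smallo_integrate:
  fixes F :: "real \<Rightarrow> 'a::real_normed_vector"
  assumes "\<delta> > 0" "F 0 = 0"
    and deriv: "\<And>h. 0 \<le> h \<Longrightarrow> h < \<delta> \<Longrightarrow> (F has_vector_derivative F' h) (at h)"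
    and small: "(\<lambda>h. norm (F' h)) \<in> o[at_right 0](\<lambda>h. h ^ n)"
  shows "(\<lambda>h. norm (F h)) \<in> o[at_right 0](\<lambda>h. h ^ Suc n)"
proof (rule landau_o.smallI)
  fix \<epsilon> :: real assume "\<epsilon> > 0"
  from landau_o.smallD[OF small this] obtain b where "b > 0"
    and b: "\<And>h. 0 < h \<Longrightarrow> h < b \<Longrightarrow> norm (F' h) \<le> \<epsilon> * \<bar>h ^ n\<bar>"
    by (auto simp: eventually_at_right_field)
  have "norm (F h) \<le> \<epsilon> * h ^ Suc n" if h: "0 < h" "h < min b \<delta>" for h
  proof -
    have "norm (F h - F 0) \<le> (\<epsilon> * h ^ n) * h - (\<epsilon> * h ^ n) * 0"
    proof (rule differentiable_bound_general[OF h(1)])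
      show "continuous_on {0..h} F"
      proof (rule continuous_at_imp_continuous_on, rule ballI)
        fix u assume "u \<in> {0..h}"
        then have "(F has_vector_derivative F' u) (at u)" using deriv[of u] h by simp
        then show "isCont F u" by (rule has_vector_derivative_continuous)
      qed
      show "continuous_on {0..h} (\<lambda>u. (\<epsilon> * h ^ n) * u)" by (intro continuous_intros)
      fix u assume u: "0 < u" "u < h"
      then show "(F has_vector_derivative F' u) (at u)" using deriv h by auto
      show "((\<lambda>u. (\<epsilon> * h ^ n) * u) has_vector_derivative \<epsilon> * h ^ n) (at u)"
        by (auto intro!: derivative_eq_intros simp: has_real_derivative_iff_has_vector_derivative[symmetric])
      have "norm (F' u) \<le> \<epsilon> * u ^ n" using b[of u] u h by simp
      also have "\<dots> \<le> \<epsilon> * h ^ n" using u \<open>\<epsilon> > 0\<close> by (intro mult_left_mono power_mono) auto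
      finally show "norm (F' u) \<le> \<epsilon> * h ^ n" .
    qed
    then show ?thesis using \<open>F 0 = 0\<close> by (simp add: mult_ac)
  qed
  then show "\<forall>\<^sub>F h in at_right 0. norm (norm (F h)) \<le> \<epsilon> * norm (h ^ Suc n)"
    using \<open>b > 0\<close> \<open>\<delta> > 0\<close>
    by (auto simp: eventually_at_right_field abs_mult intro!: exI[of _ "min b \<delta>"])
qed

section \<open>Finite differences of a smooth curve\<close>

lemma has_vector_derivative_shift:
  fixes g :: "real \<Rightarrow> 'a::real_normed_vector"
  assumes "(g has_vector_derivative D) (at (t + h))"
  shows "((\<lambda>h. g (t + h)) has_vector_derivative D) (at h)"
proof -
  have "((\<lambda>h. t + h) has_vector_derivative 1) (at h)"
    by (auto intro!: derivative_eq_intros simp: has_real_derivative_iff_has_vector_derivative[symmetric])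
  from vector_diff_chain_at[OF this assms] show ?thesis by (simp add: o_def)
qed

lemma has_vector_derivative_reflect:
  fixes g :: "real \<Rightarrow> 'a::real_normed_vector"
  assumes "(g has_vector_derivative D) (at (t - h))"
  shows "((\<lambda>h. g (t - h)) has_vector_derivative - D) (at h)"
proof -
  have "((\<lambda>h. t - h) has_vector_derivative - 1) (at h)"
    by (auto intro!: derivative_eq_intros simp: has_real_derivative_iff_has_vector_derivative[symmetric])
  from vector_diff_chain_at[OF this assms] show ?thesis by (simp add: o_def)
qed

lemma smooth_curve_on_derivatives:
  assumes "smooth_curve_on {t\<^sub>0..} X"
  obtains V A J where
    "\<And>u. u > t\<^sub>0 \<Longrightarrow> (X has_vector_derivative V u) (at u)"
    "\<And>u. u > t\<^sub>0 \<Longrightarrow> (V has_vector_derivative A u) (at u)"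
    "\<And>u. u > t\<^sub>0 \<Longrightarrow> (A has_vector_derivative J u) (at u)"
proof -
  from assms obtain D where D0: "\<And>u. u \<ge> t\<^sub>0 \<Longrightarrow> D 0 u = X u"
    and D: "\<And>n u. u \<ge> t\<^sub>0 \<Longrightarrow> (D n has_vector_derivative D (Suc n) u) (at u within {t\<^sub>0..})"
    unfolding smooth_curve_on_def by auto
  have *: "(D n has_vector_derivative D (Suc n) u) (at u)" if "u > t\<^sub>0" for n u
  proof -
    have "(D n has_vector_derivative D (Suc n) u) (at u within {t\<^sub>0<..})"
      using D[of u n] that by (auto intro: has_vector_derivative_within_subset)
    then show ?thesis using that by (simp add: at_within_open[of u "{t\<^sub>0<..}"])
  qed
  have "(X has_vector_derivative D (Suc 0) u) (at u)" if "u > t\<^sub>0" for u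
    by (rule has_vector_derivative_transform_within_open[OF *[OF that, of 0], of "{t\<^sub>0<..}"])
       (use that D0 in auto)
  with that * show thesis by blast
qed

lemma velocity_acceleration_eqI:
  fixes X :: "real \<Rightarrow> 'a::real_normed_vector"
  assumes X: "\<And>u. u > t\<^sub>0 \<Longrightarrow> (X has_vector_derivative V u) (at u)"
    and V: "\<And>u. u > t\<^sub>0 \<Longrightarrow> (V has_vector_derivative A u) (at u)"
    and "t > t\<^sub>0"
  shows "velocity X t = V t" and "acceleration X t = A t"
proof -
  have *: "velocity X u = V u" if "u > t\<^sub>0" for u
    using X[OF that] by (rule vector_derivative_at)
  show "velocity X t = V t" using * \<open>t > t\<^sub>0\<close> .
  have "(velocity X has_vector_derivative A t) (at t)"
    by (rule has_vector_derivative_transform_within_open[OF V[OF \<open>t > t\<^sub>0\<close>], of "{t\<^sub>0<..}"])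
       (use * \<open>t > t\<^sub>0\<close> in auto)
  then show "acceleration X t = A t" by (rule vector_derivative_at)
qed

lemma backward_difference_expansion:
  fixes X :: "real \<Rightarrow> 'a::real_normed_vector"
  assumes X: "\<And>u. u > t\<^sub>0 \<Longrightarrow> (X has_vector_derivative V u) (at u)"
    and V: "(V has_vector_derivative A) (at t)"
    and "t > t\<^sub>0"
  shows "(\<lambda>h. norm (X t - X (t - h) - h *\<^sub>R V t + (h\<^sup>2 / 2) *\<^sub>R A))
           \<in> o[at_right 0](\<lambda>h. h\<^sup>2)"
proof -
  let ?F = "\<lambda>h. X t - X (t - h) - h *\<^sub>R V t + (h\<^sup>2 / 2) *\<^sub>R A"
  let ?F' = "\<lambda>h. V (t - h) - V t + h *\<^sub>R A"
  have "(\<lambda>h. norm (?F' h)) \<in> o[at_right 0](\<lambda>h. h)"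
    using has_vector_derivative_smallo_remainder[OF has_vector_derivative_reflect, of V A t] V
    by simp
  moreover have "(?F has_vector_derivative ?F' h) (at h)" if "0 \<le> h" "h < t - t\<^sub>0" for h
    using that
    by (auto intro!: derivative_eq_intros has_vector_derivative_reflect[OF X])
  ultimately have "(\<lambda>h. norm (?F h)) \<in> o[at_right 0](\<lambda>h. h ^ Suc 1)"
    using \<open>t > t\<^sub>0\<close> by - (rule norm_smallo_integrate[where \<delta> = "t - t\<^sub>0" and F' = ?F'], auto)
  then show ?thesis by (simp add: numeral_2_eq_2)
qed

text \<open>
  The remainder of the symmetric difference is smaller than that of a one-sided
  one by one order: the second derivative of the remainder is
  \<open>X''(t + h) + X''(t - h) - 2 X''(t)\<close>, in which the terms linear in \<open>h\<close> cancel.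
\<close>

lemma symmetric_difference_expansion:
  fixes X :: "real \<Rightarrow> 'a::real_normed_vector"
  assumes X: "\<And>u. u > t\<^sub>0 \<Longrightarrow> (X has_vector_derivative V u) (at u)"
    and V: "\<And>u. u > t\<^sub>0 \<Longrightarrow> (V has_vector_derivative A u) (at u)"
    and A: "(A has_vector_derivative J) (at t)"
    and "t > t\<^sub>0"
  shows "(\<lambda>h. norm (X (t + h) - 2 *\<^sub>R X t + X (t - h) - h\<^sup>2 *\<^sub>R A t))
           \<in> o[at_right 0](\<lambda>h. h ^ 3)"
proof -
  let ?F = "\<lambda>h. X (t + h) - 2 *\<^sub>R X t + X (t - h) - h\<^sup>2 *\<^sub>R A t"
  let ?F' = "\<lambda>h. V (t + h) - V (t - h) - (2 * h) *\<^sub>R A t"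
  let ?F'' = "\<lambda>h. A (t + h) + A (t - h) - 2 *\<^sub>R A t"
  have "((\<lambda>h. A (t + h) + A (t - h)) has_vector_derivative J + - J) (at 0)"
    by (intro has_vector_derivative_add has_vector_derivative_shift has_vector_derivative_reflect)
       (use A in simp_all)
  from has_vector_derivative_smallo_remainder[OF this]
  have "(\<lambda>h. norm (?F'' h)) \<in> o[at_right 0](\<lambda>h. h ^ 1)"
    by (simp add: scaleR_2)
  moreover have "(?F' has_vector_derivative ?F'' h) (at h)" if "0 \<le> h" "h < t - t\<^sub>0" for h
    using that
    by (auto intro!: derivative_eq_intros has_vector_derivative_shift[OF V]
        has_vector_derivative_reflect[OF V])
  ultimately have "(\<lambda>h. norm (?F' h)) \<in> o[at_right 0](\<lambda>h. h ^ Suc 1)"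
    using \<open>t > t\<^sub>0\<close> by - (rule norm_smallo_integrate[where \<delta> = "t - t\<^sub>0" and F' = ?F''], auto)
  moreover have "(?F has_vector_derivative ?F' h) (at h)" if "0 \<le> h" "h < t - t\<^sub>0" for h
    using that
    by (auto intro!: derivative_eq_intros has_vector_derivative_shift[OF X]
        has_vector_derivative_reflect[OF X])
  ultimately have "(\<lambda>h. norm (?F h)) \<in> o[at_right 0](\<lambda>h. h ^ Suc (Suc 1))"
    using \<open>t > t\<^sub>0\<close>
    by - (rule norm_smallo_integrate[where \<delta> = "t - t\<^sub>0" and F' = ?F'], auto simp: scaleR_2)
  then show ?thesis by (simp add: numeral_3_eq_3)
qed

section \<open>The accelerated gradient algorithm\<close>

lemma C2_gradient_has_derivative:
  assumes "C2 f"
  shows "(gradient f has_derivative hessian f x) (at x)"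
  using assms unfolding C2_def hessian_def by (metis frechet_derivative_at)

text \<open>
  The extrapolation factor tends to 1 with the step, so the extrapolated point
  moves with the velocity of the curve; the chain rule then gives the
  Hessian-driven damping.
\<close>

lemma gradient_extrapolation_expansion:
  fixes f :: "'a::real_inner \<Rightarrow> real"
  assumes "C2 f" "\<alpha> > 0" "t > 0" and X: "(X has_vector_derivative v) (at t)"
  shows "(\<lambda>h. norm (gradient f (nag_extrapolation \<alpha> (t / h + \<alpha> / 2) (X (t - h)) (X t))
             - gradient f (X t) - h *\<^sub>R hessian f (X t) v)) \<in> o[at_right 0](\<lambda>h. h)"
proof -
  define Y where "Y = (\<lambda>h. X t + (1 - \<alpha> * h / (t + \<alpha> * h / 2)) *\<^sub>R (X t - X (t - h)))"
  have Y0: "Y 0 = X t" by (simp add: Y_def)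
  have "((\<lambda>h. 1 - \<alpha> * h / (t + \<alpha> * h / 2)) has_field_derivative - (\<alpha> / t)) (at 0)"
    using \<open>t > 0\<close> by (auto intro!: derivative_eq_intros simp: field_simps power2_eq_square)
  moreover have "((\<lambda>h. X t - X (t - h)) has_vector_derivative 0 - - v) (at 0)"
    by (intro has_vector_derivative_diff has_vector_derivative_const has_vector_derivative_reflect)
       (use X in simp)
  ultimately have
    "((\<lambda>h. (1 - \<alpha> * h / (t + \<alpha> * h / 2)) *\<^sub>R (X t - X (t - h))) has_vector_derivative v) (at 0)"
    using has_vector_derivative_scaleR by fastforce
  then have "(Y has_vector_derivative v) (at 0)"
    unfolding Y_def using has_vector_derivative_add[OF has_vector_derivative_const] by fastforce
  then have "((gradient f \<circ> Y) has_derivative hessian f (X t) \<circ> (\<lambda>h. h *\<^sub>R v)) (at 0)"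
    using C2_gradient_has_derivative[OF \<open>C2 f\<close>] Y0
    unfolding has_vector_derivative_def by (intro diff_chain_at) auto
  moreover have "linear (hessian f (X t))"
    using C2_gradient_has_derivative[OF \<open>C2 f\<close>] by (rule has_derivative_linear)
  ultimately have "((\<lambda>h. gradient f (Y h)) has_vector_derivative hessian f (X t) v) (at 0)"
    by (simp add: has_vector_derivative_def o_def linear_scale)
  from has_vector_derivative_smallo_remainder[OF this]
  have "(\<lambda>h. norm (gradient f (Y h) - gradient f (X t) - h *\<^sub>R hessian f (X t) v))
      \<in> o[at_right 0](\<lambda>h. h)" by (simp add: Y0)
  moreover have "nag_extrapolation \<alpha> (t / h + \<alpha> / 2) (X (t - h)) (X t) = Y h" if "h > 0" for h
  proof -
    have "\<alpha> / (t / h + \<alpha> / 2) = \<alpha> * h / (t + \<alpha> * h / 2)"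
      using that assms by (simp add: field_simps)
    then show ?thesis by (simp add: nag_extrapolation_def Y_def)
  qed
  then have "\<forall>\<^sub>F h in at_right 0.
      norm (gradient f (Y h) - gradient f (X t) - h *\<^sub>R hessian f (X t) v)
    = norm (gradient f (nag_extrapolation \<alpha> (t / h + \<alpha> / 2) (X (t - h)) (X t))
        - gradient f (X t) - h *\<^sub>R hessian f (X t) v)"
    by (auto simp: eventually_at_right_field intro!: exI[of _ 1])
  ultimately show ?thesis
    by (subst (asm) landau_o.small.in_cong)
qed

text \<open>
  An exact identity for the normalized residual: its deviation from the ODE is a
  combination of the three expansion remainders and one term of order \<open>h\<^sup>2\<close>.  The term
  \<open>(h\<^sup>2/2) a\<close> in the backward difference absorbs the contribution \<open>\<alpha> h a / (2 t)\<close> of the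
  normalizing factor.
\<close>

lemma nag_residual_decomposition:
  fixes f :: "'a::real_inner \<Rightarrow> real" and X :: "real \<Rightarrow> 'a"
  assumes "\<alpha> > 0" "h > 0" "t > 0"
  defines "\<nu> \<equiv> 1 + \<alpha> * h / (2 * t)"
    and "Y \<equiv> nag_extrapolation \<alpha> (t / h + \<alpha> / 2) (X (t - h)) (X t)"
  shows "\<nu> *\<^sub>R ansatz_residual (nag_step f \<alpha>) (- \<alpha> / 2) X h t
      - (a + h *\<^sub>R w + (\<alpha> / t) *\<^sub>R v + \<nu> *\<^sub>R gradient f (X t))
    = (\<nu> / h\<^sup>2) *\<^sub>R (X (t + h) - 2 *\<^sub>R X t + X (t - h) - h\<^sup>2 *\<^sub>R a)
      + ((\<alpha> / (t * h)) *\<^sub>R (X t - X (t - h) - h *\<^sub>R v + (h\<^sup>2 / 2) *\<^sub>R a)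
      + (\<nu> *\<^sub>R (gradient f Y - gradient f (X t) - h *\<^sub>R w)
      + (\<alpha> * h\<^sup>2 / (2 * t)) *\<^sub>R w))"
proof -
  have \<nu>: "\<nu> * (\<alpha> / (t / h + \<alpha> / 2)) = \<alpha> * h / t"
  proof -
    have "t / h + \<alpha> / 2 > 0" using assms(1-3) by (intro add_pos_pos) auto
    moreover have "\<nu> = (h / t) * (t / h + \<alpha> / 2)"
      using assms(2,3) by (simp add: \<nu>_def field_simps)
    ultimately show ?thesis by simp
  qed
  have res: "ansatz_residual (nag_step f \<alpha>) (- \<alpha> / 2) X h t
    = (1 / h\<^sup>2) *\<^sub>R (X (t + h) - 2 *\<^sub>R X t + X (t - h)
        + (\<alpha> / (t / h + \<alpha> / 2)) *\<^sub>R (X t - X (t - h))) + gradient f Y"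
    using \<open>h > 0\<close>
    by (simp add: ansatz_residual_def nag_step_def Let_def Y_def[symmetric])
       (simp add: Y_def nag_extrapolation_def algebra_simps scaleR_2)
  have "\<nu> *\<^sub>R ansatz_residual (nag_step f \<alpha>) (- \<alpha> / 2) X h t
    = (\<nu> / h\<^sup>2) *\<^sub>R (X (t + h) - 2 *\<^sub>R X t + X (t - h))
        + (1 / h\<^sup>2 * (\<nu> * (\<alpha> / (t / h + \<alpha> / 2)))) *\<^sub>R (X t - X (t - h)) + \<nu> *\<^sub>R gradient f Y"
    unfolding res by (simp add: scaleR_add_right)
  also have "1 / h\<^sup>2 * (\<nu> * (\<alpha> / (t / h + \<alpha> / 2))) = \<alpha> / (t * h)"
    unfolding \<nu> using assms(2,3) by (simp add: field_simps power2_eq_square)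
  finally have normalized: "\<nu> *\<^sub>R ansatz_residual (nag_step f \<alpha>) (- \<alpha> / 2) X h t
    = (\<nu> / h\<^sup>2) *\<^sub>R (X (t + h) - 2 *\<^sub>R X t + X (t - h))
        + (\<alpha> / (t * h)) *\<^sub>R (X t - X (t - h)) + \<nu> *\<^sub>R gradient f Y" .
  have second: "(\<nu> / h\<^sup>2) *\<^sub>R (X (t + h) - 2 *\<^sub>R X t + X (t - h) - h\<^sup>2 *\<^sub>R a)
    = (\<nu> / h\<^sup>2) *\<^sub>R (X (t + h) - 2 *\<^sub>R X t + X (t - h)) - (a + (\<alpha> * h / (2 * t)) *\<^sub>R a)"
    using \<open>h > 0\<close> by (simp add: scaleR_diff_right \<nu>_def scaleR_add_left)
  have "\<alpha> / (t * h) * h = \<alpha> / t" "\<alpha> / (t * h) * (h\<^sup>2 / 2) = \<alpha> * h / (2 * t)"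
    using assms(2,3) by (simp_all add: field_simps power2_eq_square)
  then have first: "(\<alpha> / (t * h)) *\<^sub>R (X t - X (t - h) - h *\<^sub>R v + (h\<^sup>2 / 2) *\<^sub>R a)
    = (\<alpha> / (t * h)) *\<^sub>R (X t - X (t - h)) - (\<alpha> / t) *\<^sub>R v + (\<alpha> * h / (2 * t)) *\<^sub>R a"
    by (simp only: scaleR_diff_right scaleR_add_right scaleR_scaleR)
  have "\<nu> * h = h + \<alpha> * h\<^sup>2 / (2 * t)"
    by (simp add: \<nu>_def algebra_simps power2_eq_square)
  then have grad: "\<nu> *\<^sub>R (gradient f Y - gradient f (X t) - h *\<^sub>R w)
    = \<nu> *\<^sub>R gradient f Y - \<nu> *\<^sub>R gradient f (X t) - h *\<^sub>R w - (\<alpha> * h\<^sup>2 / (2 * t)) *\<^sub>R w"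
    by (simp only: scaleR_diff_right scaleR_scaleR scaleR_add_left) simp
  show ?thesis unfolding normalized second first grad by simp
qed

lemma nag_residual_expansion:
  fixes f :: "'a::real_inner \<Rightarrow> real"
  assumes "C2 f" "\<alpha> > 0" "t\<^sub>0 > 0" "t > t\<^sub>0" "smooth_curve_on {t\<^sub>0..} X"
  shows "(\<lambda>h. norm ((1 + \<alpha> * h / (2 * t)) *\<^sub>R ansatz_residual (nag_step f \<alpha>) (- \<alpha> / 2) X h t
      - (acceleration X t + h *\<^sub>R hessian f (X t) (velocity X t) + (\<alpha> / t) *\<^sub>R velocity X t
          + (1 + \<alpha> * h / (2 * t)) *\<^sub>R gradient f (X t)))) \<in> o[at_right 0](\<lambda>h. h)"
proof -
  from assms(5) obtain V A J where
    X: "\<And>u. u > t\<^sub>0 \<Longrightarrow> (X has_vector_derivative V u) (at u)" and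
    V: "\<And>u. u > t\<^sub>0 \<Longrightarrow> (V has_vector_derivative A u) (at u)" and
    A: "\<And>u. u > t\<^sub>0 \<Longrightarrow> (A has_vector_derivative J u) (at u)"
    by (rule smooth_curve_on_derivatives) (rule that)
  have XV: "velocity X t = V t" "acceleration X t = A t"
    using velocity_acceleration_eqI[of t\<^sub>0 X V A t] X V \<open>t > t\<^sub>0\<close> by blast+
  have "t > 0" using assms by simp
  let ?\<nu> = "\<lambda>h. 1 + \<alpha> * h / (2 * t)"
  let ?Y = "\<lambda>h. nag_extrapolation \<alpha> (t / h + \<alpha> / 2) (X (t - h)) (X t)"
  let ?w = "hessian f (X t) (V t)"
  let ?S = "\<lambda>h. X (t + h) - 2 *\<^sub>R X t + X (t - h) - h\<^sup>2 *\<^sub>R A t"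
  let ?B = "\<lambda>h. X t - X (t - h) - h *\<^sub>R V t + (h\<^sup>2 / 2) *\<^sub>R A t"
  let ?G = "\<lambda>h. gradient f (?Y h) - gradient f (X t) - h *\<^sub>R ?w"
  have pos: "\<forall>\<^sub>F h in at_right 0. h > (0::real)"
    by (auto simp: eventually_at_right_field intro!: exI[of _ 1])
  have \<nu>: "?\<nu> \<in> O[at_right 0](\<lambda>_. 1)"
  proof (rule bigoI_tendsto)
    show "((\<lambda>h. ?\<nu> h / 1) \<longlongrightarrow> ?\<nu> 0 / 1) (at_right 0)"
      using \<open>t > 0\<close> by (intro tendsto_intros) auto
  qed auto
  have "(\<lambda>h. ?\<nu> h * (1 / h\<^sup>2)) \<in> O[at_right 0](\<lambda>h. 1 * (1 / h\<^sup>2))"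
    using \<nu> by (intro landau_o.big.mult) auto
  then have "(\<lambda>h. ?\<nu> h / h\<^sup>2) \<in> O[at_right 0](\<lambda>h. 1 / h\<^sup>2)" by simp
  from norm_scaleR_smallo[OF this symmetric_difference_expansion[OF X V A[OF \<open>t > t\<^sub>0\<close>] \<open>t > t\<^sub>0\<close>]]
  have "(\<lambda>h. norm ((?\<nu> h / h\<^sup>2) *\<^sub>R ?S h)) \<in> o[at_right 0](\<lambda>h. 1 / h\<^sup>2 * h ^ 3)" by simp
  also have "(\<lambda>h. 1 / h\<^sup>2 * h ^ 3) \<in> \<Theta>[at_right 0](\<lambda>h. h :: real)"
    by (rule bigthetaI_cong, rule eventually_mono[OF pos])
       (simp add: power2_eq_square power3_eq_cube)
  finally have S: "(\<lambda>h. norm ((?\<nu> h / h\<^sup>2) *\<^sub>R ?S h)) \<in> o[at_right 0](\<lambda>h. h)" .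
  have "(\<lambda>h. (\<alpha> / t) * (1 / h)) \<in> O[at_right 0](\<lambda>h. 1 * (1 / h))"
    by (intro landau_o.big.mult) auto
  then have "(\<lambda>h. \<alpha> / (t * h)) \<in> O[at_right 0](\<lambda>h. 1 / h)" by simp
  from norm_scaleR_smallo[OF this backward_difference_expansion[OF X V[OF \<open>t > t\<^sub>0\<close>] \<open>t > t\<^sub>0\<close>]]
  have "(\<lambda>h. norm ((\<alpha> / (t * h)) *\<^sub>R ?B h)) \<in> o[at_right 0](\<lambda>h. 1 / h * h\<^sup>2)" by simp
  also have "(\<lambda>h. 1 / h * h\<^sup>2) \<in> \<Theta>[at_right 0](\<lambda>h. h :: real)"
    by (rule bigthetaI_cong, rule eventually_mono[OF pos]) (simp add: power2_eq_square)
  finally have B: "(\<lambda>h. norm ((\<alpha> / (t * h)) *\<^sub>R ?B h)) \<in> o[at_right 0](\<lambda>h. h)" .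
  have G: "(\<lambda>h. norm (?\<nu> h *\<^sub>R ?G h)) \<in> o[at_right 0](\<lambda>h. h)"
    using norm_scaleR_smallo[OF \<nu> gradient_extrapolation_expansion[OF assms(1,2) \<open>t > 0\<close> X[OF \<open>t > t\<^sub>0\<close>]]]
    by simp
  have W: "(\<lambda>h. norm ((\<alpha> * h\<^sup>2 / (2 * t)) *\<^sub>R ?w)) \<in> o[at_right 0](\<lambda>h. h)"
  proof (rule smalloI_tendsto)
    have "((\<lambda>h. norm ((\<alpha> * h / (2 * t)) *\<^sub>R ?w)) \<longlongrightarrow> norm ((\<alpha> * 0 / (2 * t)) *\<^sub>R ?w)) (at_right 0)"
      using \<open>t > 0\<close> by (intro tendsto_intros) auto
    then have "((\<lambda>h. norm ((\<alpha> * h / (2 * t)) *\<^sub>R ?w)) \<longlongrightarrow> 0) (at_right 0)"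
      by simp
    moreover have "\<forall>\<^sub>F h in at_right 0. norm ((\<alpha> * h / (2 * t)) *\<^sub>R ?w)
        = norm ((\<alpha> * h\<^sup>2 / (2 * t)) *\<^sub>R ?w) / h"
      by (rule eventually_mono[OF pos]) (simp add: power2_eq_square abs_mult)
    ultimately show "((\<lambda>h. norm ((\<alpha> * h\<^sup>2 / (2 * t)) *\<^sub>R ?w) / h) \<longlongrightarrow> 0) (at_right 0)"
      by (rule Lim_transform_eventually)
  qed (use pos in \<open>auto elim: eventually_mono\<close>)
  note sum = norm_add_smallo[OF S norm_add_smallo[OF B norm_add_smallo[OF G W]]]
  have "\<forall>\<^sub>F h in at_right 0.
      norm ((?\<nu> h / h\<^sup>2) *\<^sub>R ?S h
        + ((\<alpha> / (t * h)) *\<^sub>R ?B h + (?\<nu> h *\<^sub>R ?G h + (\<alpha> * h\<^sup>2 / (2 * t)) *\<^sub>R ?w)))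
    = norm (?\<nu> h *\<^sub>R ansatz_residual (nag_step f \<alpha>) (- \<alpha> / 2) X h t
        - (A t + h *\<^sub>R ?w + (\<alpha> / t) *\<^sub>R V t + ?\<nu> h *\<^sub>R gradient f (X t)))"
    by (rule eventually_mono[OF pos])
       (simp only: nag_residual_decomposition[OF \<open>\<alpha> > 0\<close> _ \<open>t > 0\<close>])
  from iffD1[OF landau_o.small.in_cong[OF this] sum] show ?thesis
    unfolding XV .
qed

theorem theorem3p1:
  fixes f :: "'a::{real_inner, complete_space} \<Rightarrow> real" and \<alpha> :: real
  assumes "convex_on UNIV f"
    and "\<And>x. GDERIV f x :> gradient f x"
    and "\<exists>L. L-lipschitz_on UNIV (gradient f)"
    and "{x. is_arg_min f (\<lambda>_. True) x} \<noteq> {}"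
    and "\<alpha> > 0"
    and "C2 f"
  shows "\<exists>c. high_resolution_ode (nag_step f \<alpha>) c
           (\<lambda>s t x v a. a + sqrt s *\<^sub>R hessian f x v + (\<alpha> / t) *\<^sub>R v
                        + (1 + \<alpha> * sqrt s / (2 * t)) *\<^sub>R gradient f x)"
proof (rule exI[of _ "- \<alpha> / 2"], unfold high_resolution_ode_def, intro conjI)
  let ?E = "\<lambda>s t x v a. a + sqrt s *\<^sub>R hessian f x v + (\<alpha> / t) *\<^sub>R v
                        + (1 + \<alpha> * sqrt s / (2 * t)) *\<^sub>R gradient f x"
  show "\<exists>G\<^sub>0 G\<^sub>1. \<forall>s>0. \<forall>t>0. \<forall>x v a. ?E s t x v a = a + G\<^sub>0 t x v + sqrt s *\<^sub>R G\<^sub>1 t x v"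
    by (rule exI[of _ "\<lambda>t x v. (\<alpha> / t) *\<^sub>R v + gradient f x"],
        rule exI[of _ "\<lambda>t x v. hessian f x v + (\<alpha> / (2 * t)) *\<^sub>R gradient f x"])
       (simp add: algebra_simps)
  show "\<exists>\<nu> :: real \<Rightarrow> real \<Rightarrow> real. (\<forall>h>0. \<forall>t>0. \<nu> h t \<noteq> 0) \<and>
        (\<forall>t\<^sub>0>0. \<forall>X. smooth_curve_on {t\<^sub>0..} X \<longrightarrow>
           (\<forall>t>t\<^sub>0. (\<lambda>h. norm (\<nu> h t *\<^sub>R ansatz_residual (nag_step f \<alpha>) (- \<alpha> / 2) X h t
                       - ?E (h\<^sup>2) t (X t) (velocity X t) (acceleration X t)))
                     \<in> o[at_right 0](\<lambda>h. h)))"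
  proof (rule exI[of _ "\<lambda>h t. 1 + \<alpha> * h / (2 * t)"], intro conjI allI impI)
    fix h t :: real assume "h > 0" "t > 0"
    with \<open>\<alpha> > 0\<close> have "\<alpha> * h / (2 * t) > 0" by simp
    then show "1 + \<alpha> * h / (2 * t) \<noteq> 0" by linarith
  next
    fix t\<^sub>0 t :: real and X :: "real \<Rightarrow> 'a" assume *: "t\<^sub>0 > 0" "smooth_curve_on {t\<^sub>0..} X" "t > t\<^sub>0"
    \<comment> \<open>\<open>sqrt (h\<^sup>2)\<close> is \<open>\<bar>h\<bar>\<close>, which is \<open>h\<close> only for the positive steps near \<open>0\<close>.\<close>
    have "\<forall>\<^sub>F h in at_right 0. sqrt (h\<^sup>2) = (h::real)"
      by (auto simp: eventually_at_right_field intro!: exI[of _ 1])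
    then have "\<forall>\<^sub>F h in at_right 0.
        norm ((1 + \<alpha> * h / (2 * t)) *\<^sub>R ansatz_residual (nag_step f \<alpha>) (- \<alpha> / 2) X h t
          - ?E (h\<^sup>2) t (X t) (velocity X t) (acceleration X t))
      = norm ((1 + \<alpha> * h / (2 * t)) *\<^sub>R ansatz_residual (nag_step f \<alpha>) (- \<alpha> / 2) X h t
          - (acceleration X t + h *\<^sub>R hessian f (X t) (velocity X t) + (\<alpha> / t) *\<^sub>R velocity X t
              + (1 + \<alpha> * h / (2 * t)) *\<^sub>R gradient f (X t)))"
      by (rule eventually_mono) (simp only:)
    then show "(\<lambda>h. norm ((1 + \<alpha> * h / (2 * t)) *\<^sub>R ansatz_residual (nag_step f \<alpha>) (- \<alpha> / 2) X h t
          - ?E (h\<^sup>2) t (X t) (velocity X t) (acceleration X t))) \<in> o[at_right 0](\<lambda>h. h)"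
      by (rule iffD2[OF landau_o.small.in_cong])
         (rule nag_residual_expansion[OF \<open>C2 f\<close> \<open>\<alpha> > 0\<close> *(1,3,2)])
  qed
qed

end
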